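(* Let $N\ge1$ and $L\ge0$ be integers, $\sigma_b^2>0$ and $0<\sigma_w^2<2$. Consider the energy of the rectified linear stochastic network on a ring, $$\mathcal L=\frac12\sum_{l=0}^L\Bigg(\frac{(r_+^l)^2+(r_-^l)^2}{\sigma_w^2N^{-1}(r_+^{l-1})^2+\sigma_b^2}+N\log\big(\sigma_w^2N^{-1}(r_+^l)^2+\sigma_b^2\big)+(N-k_l)\big(3\log(N-k_l)-2\log r_+^l\big)+k_l\big(3\log k_l-2\log r_-^l\big)\Bigg),$$ a function of the fields $r_+^l\in(0,\infty)$, $r_-^l\in(0,\infty)$, $k_l\in(0,N)$ $(l=0,\dots,L)$ with the periodic identification $r_+^{-1}=r_+^L$. Then there is a uniform configuration of fields $r_+^l=r_+$, $r_-^l=r_-$, $k_l=k$ (independent of $l$) that minimizes $\mathcal L$, and it is given by $$r_+=r_-=\sqrt{\frac{N\sigma_b^2}{2(1-\sigma_w^2/2)}},\qquad k=\frac N2 .$$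
   Context: Superscripts $l$ are layer indices, not powers. In the source, $r_+^l$ and $r_-^l$ are the norms of the vectors of positive and negative components of the pre-activations in layer $l$ of a random network with activation $\phi(z)=\max(0,z)$, constant width $N$, weight variance $\sigma_w^2/N$ and bias variance $\sigma_b^2$, and $k_l$ is a continuous relaxation of the number of components of one fixed sign; $\mathcal L$ is the resulting large-$N$ (Stirling) energy on a periodic chain of layers. *)

theory Defs
  imports Complex_Main
begin

(* Configurations are triples (rp, rm, k) of fields indexed by layers; only the
   layers 0..L matter. *)
type_synonym fields = "(nat \<Rightarrow> real) \<times> (nat \<Rightarrow> real) \<times> (nat \<Rightarrow> real)"

(* Predecessor on the ring of layers 0..L; layer -1 is identified with layer L. *)
definition prev_layer :: "nat \<Rightarrow> nat \<Rightarrow> nat" where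
  "prev_layer L l = (if l = 0 then L else l - 1)"

definition admissible :: "nat \<Rightarrow> nat \<Rightarrow> fields \<Rightarrow> bool" where
  "admissible N L = (\<lambda>(rp, rm, k). \<forall>l\<le>L. 0 < rp l \<and> 0 < rm l \<and> 0 < k l \<and> k l < real N)"

definition energy :: "nat \<Rightarrow> nat \<Rightarrow> real \<Rightarrow> real \<Rightarrow> fields \<Rightarrow> real" where
  "energy N L \<sigma>w \<sigma>b = (\<lambda>(rp, rm, k).
     (1 / 2) * (\<Sum>l = 0..L.
         ((rp l)\<^sup>2 + (rm l)\<^sup>2) / (\<sigma>w\<^sup>2 / real N * (rp (prev_layer L l))\<^sup>2 + \<sigma>b\<^sup>2)
       + real N * ln (\<sigma>w\<^sup>2 / real N * (rp l)\<^sup>2 + \<sigma>b\<^sup>2)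
       + (real N - k l) * (3 * ln (real N - k l) - 2 * ln (rp l))
       + k l * (3 * ln (k l) - 2 * ln (rm l))))"

definition minimizes_energy :: "nat \<Rightarrow> nat \<Rightarrow> real \<Rightarrow> real \<Rightarrow> fields \<Rightarrow> bool" where
  "minimizes_energy N L \<sigma>w \<sigma>b = is_arg_min (energy N L \<sigma>w \<sigma>b) (admissible N L)"

definition uniform_fields :: "real \<Rightarrow> real \<Rightarrow> real \<Rightarrow> fields" where
  "uniform_fields rp rm k = (\<lambda>l. rp, \<lambda>l. rm, \<lambda>l. k)"

end

theory Submission
  imports Defs
begin

text \<open>
  Write \<open>V\<close> for the variance \<open>\<sigma>w\<^sup>2 / N * rp\<^sup>2 + \<sigma>b\<^sup>2\<close>. Measuring the squared radii of a layer in units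
  of the variance of the preceding layer decouples the layers: the leftover logarithms
  \<open>N * ln V\<close> cancel around the ring. What remains is a constant plus a sum of generalised relative
  entropies, comparing \<open>N - k\<close> and \<open>k\<close> with the rescaled squared radii and with \<open>N / 2\<close>. All of
  them vanish exactly when \<open>k = N / 2\<close> and both squared radii are \<open>N / 2 * V\<close>; for a uniform
  configuration this is a linear equation for \<open>rp\<^sup>2\<close>.
\<close>

text \<open>One term of the generalised Kullback-Leibler divergence; the correction
  \<open>- x + y\<close> keeps it nonnegative at positive arguments without any
  normalisation.\<close>

definition rel_entropy :: "real \<Rightarrow> real \<Rightarrow> real" where
  "rel_entropy x y = x * (ln x - ln y) - x + y"

lemma rel_entropy_self [simp]: "rel_entropy x x = 0"
  by (simp add: rel_entropy_def)

text \<open>With \<open>t = y / x\<close>, the bound \<open>ln t \<le> t - 1\<close>, strict except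
  at \<open>t = 1\<close>, gives both the sign and the equality case.\<close>

lemma rel_entropy_eq:
  assumes "x > 0" "y > 0"
  shows "rel_entropy x y = x * (y / x - 1 - ln (y / x))"
  using assms by (simp add: rel_entropy_def ln_div field_simps)

lemma rel_entropy_nonneg:
  assumes "x > 0" "y > 0"
  shows "rel_entropy x y \<ge> 0"
  using assms ln_le_minus_one[of "y / x"] by (simp add: rel_entropy_eq)

lemma rel_entropy_eq_0_iff:
  assumes "x > 0" "y > 0"
  shows "rel_entropy x y = 0 \<longleftrightarrow> x = y"
  using assms ln_eq_minus_one[of "y / x"] by (auto simp: rel_entropy_eq)

definition variance :: "nat \<Rightarrow> real \<Rightarrow> real \<Rightarrow> real \<Rightarrow> real" where
  "variance N \<sigma>w \<sigma>b r = \<sigma>w\<^sup>2 / real N * r\<^sup>2 + \<sigma>b\<^sup>2"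

lemma variance_pos: "\<sigma>b\<^sup>2 > 0 \<Longrightarrow> variance N \<sigma>w \<sigma>b r > 0"
  by (simp add: variance_def add_nonneg_pos)

text \<open>The weights 1 and 2 split the coefficient 3 of \<open>ln (n - k)\<close> and
  \<open>ln k\<close> in the energy: one share is compared with the rescaled squared radii, the
  other two with \<open>n / 2\<close>.\<close>

definition layer_excess :: "real \<Rightarrow> real \<Rightarrow> real \<Rightarrow> real \<Rightarrow> real \<Rightarrow> real" where
  "layer_excess n k V a b =
     rel_entropy (n - k) (a / V) + rel_entropy k (b / V)
     + 2 * (rel_entropy (n - k) (n / 2) + rel_entropy k (n / 2))"

lemma layer_excess_nonneg:
  assumes "0 < k" "k < n" "V > 0" "a > 0" "b > 0"
  shows "layer_excess n k V a b \<ge> 0"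
  using assms unfolding layer_excess_def
  by (intro add_nonneg_nonneg mult_nonneg_nonneg rel_entropy_nonneg) auto

lemma layer_excess_eq_0_iff:
  assumes "0 < k" "k < n" "V > 0" "a > 0" "b > 0"
  shows "layer_excess n k V a b = 0 \<longleftrightarrow> k = n / 2 \<and> a = n / 2 * V \<and> b = n / 2 * V"
proof -
  have "rel_entropy (n - k) (a / V) \<ge> 0" "rel_entropy k (b / V) \<ge> 0"
    "rel_entropy (n - k) (n / 2) \<ge> 0" "rel_entropy k (n / 2) \<ge> 0"
    using assms by (auto intro!: rel_entropy_nonneg)
  then have "layer_excess n k V a b = 0 \<longleftrightarrow>
      rel_entropy (n - k) (a / V) = 0 \<and> rel_entropy k (b / V) = 0 \<and>
      rel_entropy (n - k) (n / 2) = 0 \<and> rel_entropy k (n / 2) = 0"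
    unfolding layer_excess_def by auto
  also have "\<dots> \<longleftrightarrow> n - k = a / V \<and> k = b / V \<and> n - k = n / 2 \<and> k = n / 2"
    using assms by (simp add: rel_entropy_eq_0_iff)
  also have "\<dots> \<longleftrightarrow> k = n / 2 \<and> a = n / 2 * V \<and> b = n / 2 * V"
    using assms by (auto simp: field_simps)
  finally show ?thesis .
qed

text \<open>\<open>V\<close> stands for the variance of the preceding layer, \<open>lnW\<close> for
  the log-variance of the layer itself. The terms in \<open>ln V\<close> carry total weight
  \<open>(n - k) + k = n\<close>, so the remainder \<open>n * (lnW - ln V)\<close> is free of
  \<open>k\<close>.\<close>

lemma layer_energy_eq:
  assumes "0 < k" "k < n" "V > 0" "rp > 0" "rm > 0"
  shows "(rp\<^sup>2 + rm\<^sup>2) / V + n * lnW + (n - k) * (3 * ln (n - k) - 2 * ln rp)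
       + k * (3 * ln k - 2 * ln rm)
     = n + 2 * n * ln (n / 2) + n * (lnW - ln V) + layer_excess n k V (rp\<^sup>2) (rm\<^sup>2)"
proof -
  have "ln (rp\<^sup>2 / V) = 2 * ln rp - ln V" "ln (rm\<^sup>2 / V) = 2 * ln rm - ln V"
    using assms by (simp_all add: ln_div ln_realpow)
  then show ?thesis
    unfolding layer_excess_def rel_entropy_def by (simp only:) (simp add: algebra_simps add_divide_distrib)
qed

text \<open>On the layers up to \<open>L\<close>, \<open>prev_layer L\<close> is a cyclic
  permutation; its inverse sends \<open>L\<close> to 0.\<close>

lemma sum_prev_layer:
  fixes f :: "nat \<Rightarrow> 'a :: comm_monoid_add"
  shows "(\<Sum>l = 0..L. f (prev_layer L l)) = (\<Sum>l = 0..L. f l)"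
  by (rule sum.reindex_bij_witness[where i = "\<lambda>l. if l = L then 0 else Suc l" and j = "prev_layer L"])
     (auto simp: prev_layer_def)

lemma energy_eq:
  assumes "admissible N L (rp, rm, k)" and "\<sigma>b\<^sup>2 > 0"
  shows "energy N L \<sigma>w \<sigma>b (rp, rm, k) =
    (1 / 2) * (real (Suc L) * (real N + 2 * real N * ln (real N / 2))
      + (\<Sum>l = 0..L. layer_excess (real N) (k l)
            (variance N \<sigma>w \<sigma>b (rp (prev_layer L l))) ((rp l)\<^sup>2) ((rm l)\<^sup>2)))"
proof -
  let ?V = "\<lambda>l. variance N \<sigma>w \<sigma>b (rp l)"
  let ?x = "\<lambda>l. layer_excess (real N) (k l) (?V (prev_layer L l)) ((rp l)\<^sup>2) ((rm l)\<^sup>2)"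
  let ?c = "real N + 2 * real N * ln (real N / 2)"
  have "energy N L \<sigma>w \<sigma>b (rp, rm, k) =
      (1 / 2) * (\<Sum>l = 0..L. ?c + real N * (ln (?V l) - ln (?V (prev_layer L l))) + ?x l)"
    unfolding energy_def case_prod_conv variance_def[symmetric]
    using assms
    by (intro arg_cong[where f = "\<lambda>s. (1 / 2) * s"] sum.cong refl layer_energy_eq)
       (auto simp: admissible_def variance_pos prev_layer_def)
  \<comment> \<open>The log-variances of the layers and of their predecessors have equal sums, so
    their differences drop out.\<close>
  also have "(\<Sum>l = 0..L. ?c + real N * (ln (?V l) - ln (?V (prev_layer L l))) + ?x l)
      = real (Suc L) * ?c + (\<Sum>l = 0..L. ?x l)"
    by (simp only: sum.distrib sum_distrib_left[symmetric] sum_subtractf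
          sum_prev_layer[of "\<lambda>l. ln (?V l)" L]) (simp add: algebra_simps)
  finally show ?thesis .
qed

theorem mainTheorem6:
  fixes N L :: nat and \<sigma>w \<sigma>b :: real
  assumes "N \<ge> 1" and "\<sigma>b\<^sup>2 > 0" and "0 < \<sigma>w\<^sup>2" and "\<sigma>w\<^sup>2 < 2"
  shows "(\<exists>rp rm k. minimizes_energy N L \<sigma>w \<sigma>b (uniform_fields rp rm k)) \<and>
    (\<forall>rp rm k. minimizes_energy N L \<sigma>w \<sigma>b (uniform_fields rp rm k) \<longrightarrow>
       rp = sqrt (real N * \<sigma>b\<^sup>2 / (2 * (1 - \<sigma>w\<^sup>2 / 2))) \<and>
       rm = sqrt (real N * \<sigma>b\<^sup>2 / (2 * (1 - \<sigma>w\<^sup>2 / 2))) \<and>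
       k = real N / 2)"
proof -
  define a where "a = real N * \<sigma>b\<^sup>2 / (2 * (1 - \<sigma>w\<^sup>2 / 2))"
  \<comment> \<open>The energy that remains when every layer excess vanishes.\<close>
  define C where "C = (1 / 2) * (real (Suc L) * (real N + 2 * real N * ln (real N / 2)))"
  let ?opt = "uniform_fields (sqrt a) (sqrt a) (real N / 2)"
  have a_pos: "a > 0"
    using assms by (simp add: a_def)
  \<comment> \<open>The stationarity condition is linear in \<open>x\<^sup>2\<close>; since
    \<open>1 - \<sigma>w\<^sup>2 / 2 > 0\<close>, it can be solved, and only by
    \<open>a\<close>.\<close>
  have a_unique: "x\<^sup>2 = real N / 2 * variance N \<sigma>w \<sigma>b x \<longleftrightarrow> x\<^sup>2 = a" for x
  proof -
    have "real N / 2 * variance N \<sigma>w \<sigma>b x = \<sigma>w\<^sup>2 / 2 * x\<^sup>2 + real N * \<sigma>b\<^sup>2 / 2"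
      using assms(1) by (simp add: variance_def field_simps)
    moreover have "x\<^sup>2 = a \<longleftrightarrow> x\<^sup>2 = \<sigma>w\<^sup>2 / 2 * x\<^sup>2 + real N * \<sigma>b\<^sup>2 / 2"
      using assms(4) by (auto simp: a_def field_simps)
    ultimately show ?thesis
      by (simp only:)
  qed
  have excess_nonneg: "layer_excess (real N) (k l) (variance N \<sigma>w \<sigma>b (rp (prev_layer L l)))
      ((rp l)\<^sup>2) ((rm l)\<^sup>2) \<ge> 0" if "admissible N L (rp, rm, k)" "l \<in> {0..L}" for rp rm k l
    using that assms by (intro layer_excess_nonneg variance_pos) (auto simp: admissible_def)
  have opt_admissible: "admissible N L ?opt"
    using assms a_pos by (simp add: admissible_def uniform_fields_def)
  have opt_excess:
    "layer_excess (real N) (real N / 2) (variance N \<sigma>w \<sigma>b (sqrt a)) ((sqrt a)\<^sup>2) ((sqrt a)\<^sup>2) = 0"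
    using assms a_pos a_unique[of "sqrt a"]
    by (subst layer_excess_eq_0_iff) (auto intro: variance_pos)
  have opt_energy: "energy N L \<sigma>w \<sigma>b ?opt = C"
    using energy_eq[OF opt_admissible[unfolded uniform_fields_def] assms(2)] opt_excess
    by (simp add: uniform_fields_def C_def)
  have lower_bound: "C \<le> energy N L \<sigma>w \<sigma>b \<phi>" if "admissible N L \<phi>" for \<phi>
  proof (cases \<phi>)
    case (fields rp rm k)
    then have adm: "admissible N L (rp, rm, k)"
      using that by simp
    show ?thesis
      unfolding fields C_def energy_eq[OF adm assms(2)]
      using sum_nonneg[OF excess_nonneg[OF adm], of "{0..L}"] by simp
  qed
  have "minimizes_energy N L \<sigma>w \<sigma>b ?opt"
    using opt_admissible opt_energy lower_bound
    by (auto simp: minimizes_energy_def is_arg_min_linorder)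
  moreover have "rp = sqrt a \<and> rm = sqrt a \<and> k = real N / 2"
    if min: "minimizes_energy N L \<sigma>w \<sigma>b (uniform_fields rp rm k)" for rp rm k
  proof -
    let ?x = "layer_excess (real N) k (variance N \<sigma>w \<sigma>b rp) (rp\<^sup>2) (rm\<^sup>2)"
    have adm: "admissible N L (\<lambda>l. rp, \<lambda>l. rm, \<lambda>l. k)"
      and le: "energy N L \<sigma>w \<sigma>b (\<lambda>l. rp, \<lambda>l. rm, \<lambda>l. k) \<le> C"
      using min opt_admissible opt_energy
      by (auto simp: minimizes_energy_def is_arg_min_linorder uniform_fields_def)
    have pos: "rp > 0" "rm > 0" "k > 0" "k < real N"
      using adm by (auto simp: admissible_def)
    \<comment> \<open>The energy is at most that of \<open>?opt\<close>, and in a uniform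
      configuration all \<open>Suc L\<close> layers have the same excess \<open>?x\<close>.\<close>
    have "real (Suc L) * ?x \<le> 0"
      using le energy_eq[OF adm assms(2), of \<sigma>w] by (simp add: C_def)
    then have "?x \<le> 0"
      by (simp add: mult_le_0_iff)
    moreover have "?x \<ge> 0"
      using excess_nonneg[OF adm, of 0] by simp
    ultimately have "k = real N / 2 \<and> rp\<^sup>2 = real N / 2 * variance N \<sigma>w \<sigma>b rp \<and>
        rm\<^sup>2 = real N / 2 * variance N \<sigma>w \<sigma>b rp"
      using layer_excess_eq_0_iff[of k "real N" "variance N \<sigma>w \<sigma>b rp" "rp\<^sup>2" "rm\<^sup>2"]
        pos variance_pos[OF assms(2)] by simp
    then have "k = real N / 2" "rp\<^sup>2 = a" "rm\<^sup>2 = a"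
      using a_unique[of rp] by auto
    \<comment> \<open>Positivity of the radii selects the positive root.\<close>
    then show ?thesis
      using pos by (auto simp: real_sqrt_unique)
  qed
  ultimately show ?thesis
    unfolding a_def by blast
qed

end
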